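(* Let $(G_n)_n$ be a sequence of finite graphs with $|G_n|\to\infty$, let $o_n\in G_n$ be a vertex for each $n$, and let $(x_n)_n$ be a sequence of positive real numbers that is critical for $(o_n,G_n)_n$. Let $(y_n)_n$ be a sequence of positive real numbers. Then $(y_n)_n$ is critical for $(o_n,G_n)_n$ if and only if $\frac{x_n}{y_n}\to 1$ as $n\to\infty$.
   Context: $|G|$ denotes the number of vertices of a finite graph $G$. A path $\omega=(\omega_0,\dots,\omega_m)$ in a graph $G$ is a sequence of vertices with $\omega_j$ adjacent to $\omega_{j+1}$ for all $j<m$; its length is $|\omega|=m$. It is self-avoiding if its vertices are pairwise distinct. For a vertex $o$ of $G$, $\mathsf{SAW}(o,G)$ is the set of finite self-avoiding paths in $G$ starting at $o$ (including the path of length $0$), and for real $x>0$ the partition function is $Z_{o,G}(x)=\sum_{\omega\in \mathsf{SAW}(o,G)}x^{|\omega|}$. For a sequence of finite graphs $G_n$ with $|G_n|\to\infty$ and vertices $o_n\in G_n$, a sequence $(x_n)_n$ of positive reals is: super-critical if $\liminf_{n\to\infty}Z_{o_n,G_n}(x_n)=\infty$; sub-critical if $\limsup_{n\to\infty}Z_{o_n,G_n}(x_n)<\infty$; critical if for any $0<\varepsilon<1$ the sequence $(x_n(1+\varepsilon))_n$ is super-critical and the sequence $(x_n(1-\varepsilon))_n$ is sub-critical. *)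

theory Defs
  imports Complex_Main "HOL-Library.Extended_Real" "Graph_Theory.Vertex_Walk"
begin

definition SAW :: "'a \<Rightarrow> ('a, 'b) pre_digraph \<Rightarrow> 'a vwalk set" where
  "SAW v G = {p. vpath p G \<and> hd p = v}"

definition partition_fun :: "'a \<Rightarrow> ('a, 'b) pre_digraph \<Rightarrow> real \<Rightarrow> real" where
  "partition_fun v G x = (\<Sum>p\<in>SAW v G. x ^ vwalk_length p)"

(* SAW v G is a finite set whenever G has finitely many vertices, so that the sum above does
   not fall back to the default value 0 for infinite index sets. *)
lemma finite_SAW:
  assumes "finite (verts G)"
  shows "finite (SAW v G)"
proof (rule finite_subset)
  show "SAW v G \<subseteq> {p. set p \<subseteq> verts G \<and> length p \<le> card (verts G)}"
    using assms
    by (auto simp: SAW_def vpath_def vwalk_def distinct_card[symmetric] intro!: card_mono)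
  show "finite {p. set p \<subseteq> verts G \<and> length p \<le> card (verts G)}"
    using assms by (rule finite_lists_length_le)
qed

(* The limits are taken in the extended reals. The three notions are meant for sequences x of
   positive reals; positivity is a hypothesis wherever they are used. *)

definition super_critical ::
    "(nat \<Rightarrow> 'a) \<Rightarrow> (nat \<Rightarrow> ('a, 'b) pre_digraph) \<Rightarrow> (nat \<Rightarrow> real) \<Rightarrow> bool" where
  "super_critical v G x \<longleftrightarrow> liminf (\<lambda>n. ereal (partition_fun (v n) (G n) (x n))) = \<infinity>"

definition sub_critical ::
    "(nat \<Rightarrow> 'a) \<Rightarrow> (nat \<Rightarrow> ('a, 'b) pre_digraph) \<Rightarrow> (nat \<Rightarrow> real) \<Rightarrow> bool" where
  "sub_critical v G x \<longleftrightarrow> limsup (\<lambda>n. ereal (partition_fun (v n) (G n) (x n))) < \<infinity>"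

definition critical ::
    "(nat \<Rightarrow> 'a) \<Rightarrow> (nat \<Rightarrow> ('a, 'b) pre_digraph) \<Rightarrow> (nat \<Rightarrow> real) \<Rightarrow> bool" where
  "critical v G x \<longleftrightarrow>
    (\<forall>\<epsilon>. 0 < \<epsilon> \<and> \<epsilon> < 1 \<longrightarrow>
      super_critical v G (\<lambda>n. x n * (1 + \<epsilon>)) \<and> sub_critical v G (\<lambda>n. x n * (1 - \<epsilon>)))"

end

theory Submission
  imports Defs
begin

text \<open>
  The partition function is a polynomial with nonnegative coefficients, hence increasing in its
  positive argument. Two consequences carry the proof. First, super-criticality passes to larger
  sequences and sub-criticality to smaller ones (\<open>super_critical_mono\<close>, \<open>sub_critical_mono\<close>).
  Second, a sub-critical sequence is eventually below every super-critical one
  (\<open>sub_critical_eventually_less\<close>), because its partition functions stay below a constant that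
  the others eventually exceed.

  If \<open>x\<close> and \<open>y\<close> are both critical, the second fact compares \<open>y (1 - \<epsilon>)\<close> with \<open>x (1 + \<epsilon>)\<close>, and
  symmetrically \<open>x (1 - \<epsilon>)\<close> with \<open>y (1 + \<epsilon>)\<close>, which confines \<open>x / y\<close> to an arbitrarily small
  neighbourhood of \<open>1\<close>. Conversely, if \<open>x / y\<close> tends to \<open>1\<close>, then eventually
  \<open>x (1 + \<epsilon>/2) \<le> y (1 + \<epsilon>)\<close> and \<open>y (1 - \<epsilon>) \<le> x (1 - \<epsilon>/2)\<close>, so the first fact transfers
  criticality from \<open>x\<close> to \<open>y\<close>.
\<close>

lemma partition_fun_mono:
  assumes "0 \<le> x" "x \<le> y"
  shows "partition_fun v G x \<le> partition_fun v G y"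
  unfolding partition_fun_def using assms by (intro sum_mono power_mono)

lemma super_critical_mono:
  assumes "super_critical v G x" "\<And>n. 0 \<le> x n" "\<forall>\<^sub>F n in sequentially. x n \<le> y n"
  shows "super_critical v G y"
proof -
  have "\<forall>\<^sub>F n in sequentially.
      ereal (partition_fun (v n) (G n) (x n)) \<le> ereal (partition_fun (v n) (G n) (y n))"
    using assms(3) by eventually_elim (simp add: partition_fun_mono assms(2))
  from Liminf_mono[OF this] show ?thesis
    using assms(1) unfolding super_critical_def by simp
qed

lemma sub_critical_mono:
  assumes "sub_critical v G y" "\<And>n. 0 \<le> x n" "\<forall>\<^sub>F n in sequentially. x n \<le> y n"
  shows "sub_critical v G x"
proof -
  have "\<forall>\<^sub>F n in sequentially.
      ereal (partition_fun (v n) (G n) (x n)) \<le> ereal (partition_fun (v n) (G n) (y n))"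
    using assms(3) by eventually_elim (simp add: partition_fun_mono assms(2))
  from Limsup_mono[OF this] show ?thesis
    using assms(1) unfolding sub_critical_def by (rule le_less_trans)
qed

text \<open>
  A real number strictly between the finite upper limit along \<open>y\<close> and the infinite lower limit
  along \<open>x\<close> eventually separates the two partition functions; by monotonicity their arguments
  are then ordered in the same way.
\<close>

lemma sub_critical_eventually_less:
  assumes "sub_critical v G y" "super_critical v G x" "\<And>n. 0 \<le> x n"
  shows "\<forall>\<^sub>F n in sequentially. y n < x n"
proof -
  obtain C where C: "limsup (\<lambda>n. ereal (partition_fun (v n) (G n) (y n))) < ereal C"
    using assms(1) ereal_dense2 unfolding sub_critical_def by blast
  have "ereal C < liminf (\<lambda>n. ereal (partition_fun (v n) (G n) (x n)))"
    using assms(2) unfolding super_critical_def by simp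
  from less_LiminfD[OF this] Limsup_lessD[OF C] show ?thesis
  proof eventually_elim
    case (elim n)
    then have "partition_fun (v n) (G n) (y n) < partition_fun (v n) (G n) (x n)"
      by simp
    then show ?case
      using partition_fun_mono[OF assms(3)] by (meson leD not_le_imp_less)
  qed
qed

lemma critical_eventually_less:
  assumes "critical v G x" "critical v G y" "\<And>n. 0 < x n" "0 < \<delta>"
  shows "\<forall>\<^sub>F n in sequentially. y n < x n * (1 + \<delta>)"
proof -
  (* This choice solves (1 + \<epsilon>) / (1 - \<epsilon>) = 1 + \<delta>. *)
  define \<epsilon> where "\<epsilon> = \<delta> / (2 + \<delta>)"
  have \<epsilon>: "0 < \<epsilon>" "\<epsilon> < 1" and ratio: "1 + \<epsilon> = (1 + \<delta>) * (1 - \<epsilon>)"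
    using assms(4) by (simp_all add: \<epsilon>_def field_simps)
  have "\<forall>\<^sub>F n in sequentially. y n * (1 - \<epsilon>) < x n * (1 + \<epsilon>)"
  proof (rule sub_critical_eventually_less)
    show "sub_critical v G (\<lambda>n. y n * (1 - \<epsilon>))" "super_critical v G (\<lambda>n. x n * (1 + \<epsilon>))"
      using assms(1,2) \<epsilon> unfolding critical_def by blast+
    show "0 \<le> x n * (1 + \<epsilon>)" for n
      using assms(3)[of n] \<epsilon> by simp
  qed
  then show ?thesis
  proof eventually_elim
    case (elim n)
    then have "y n * (1 - \<epsilon>) < (x n * (1 + \<delta>)) * (1 - \<epsilon>)"
      unfolding ratio by (simp only: mult.assoc)
    then show ?case
      using \<epsilon>(2) by simp
  qed
qed

lemma critical_ratio_tendsto_1: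
  assumes "critical v G x" "critical v G y" "\<And>n. 0 < x n" "\<And>n. 0 < y n"
  shows "(\<lambda>n. x n / y n) \<longlonglongrightarrow> 1"
proof (rule tendstoI)
  fix \<delta> :: real assume \<delta>: "0 < \<delta>"
  from critical_eventually_less[OF assms(1,2,3) \<delta>] critical_eventually_less[OF assms(2,1,4) \<delta>]
  show "\<forall>\<^sub>F n in sequentially. dist (x n / y n) 1 < \<delta>"
  proof eventually_elim
    case (elim n)
    have upper: "x n / y n < 1 + \<delta>"
      using elim(2) assms(4)[of n] by (simp add: field_simps)
    (* The lower bound follows from 1 < (x / y) (1 + \<delta>) and (1 - \<delta>) (1 + \<delta>) \<le> 1. *)
    have "(1 - \<delta>) * (1 + \<delta>) \<le> 1"
      by (simp add: algebra_simps)
    also have "1 < x n / y n * (1 + \<delta>)"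
      using elim(1) assms(4)[of n] by (simp add: field_simps)
    finally have "1 - \<delta> < x n / y n"
      by (rule mult_right_less_imp_less) (use \<delta> in simp)
    with upper show ?case
      by (simp add: dist_real_def abs_less_iff)
  qed
qed

lemma critical_if_ratio_tendsto_1:
  assumes "critical v G x" "\<And>n. 0 < x n" "\<And>n. 0 < y n" "(\<lambda>n. x n / y n) \<longlonglongrightarrow> 1"
  shows "critical v G y"
  unfolding critical_def
proof (intro allI impI conjI)
  fix \<epsilon> :: real assume \<epsilon>: "0 < \<epsilon> \<and> \<epsilon> < 1"
  have half: "super_critical v G (\<lambda>n. x n * (1 + \<epsilon>/2))" "sub_critical v G (\<lambda>n. x n * (1 - \<epsilon>/2))"
    using assms(1) \<epsilon> unfolding critical_def by auto
  show "super_critical v G (\<lambda>n. y n * (1 + \<epsilon>))"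
  proof (rule super_critical_mono[OF half(1)])
    show "0 \<le> x n * (1 + \<epsilon>/2)" for n
      using assms(2)[of n] \<epsilon> by simp
    have "1 < (1 + \<epsilon>) / (1 + \<epsilon>/2)"
      using \<epsilon> by (simp add: field_simps)
    from order_tendstoD(2)[OF assms(4) this]
    show "\<forall>\<^sub>F n in sequentially. x n * (1 + \<epsilon>/2) \<le> y n * (1 + \<epsilon>)"
    proof eventually_elim
      case (elim n)
      moreover have "0 < 1 + \<epsilon>/2"
        using \<epsilon> by simp
      ultimately have "x n * (1 + \<epsilon>/2) < (1 + \<epsilon>) * y n"
        using assms(3)[of n] by (simp only: divide_less_eq less_divide_eq if_True times_divide_eq_left)
      then show ?case
        by (simp add: mult.commute)
    qed
  qed
  show "sub_critical v G (\<lambda>n. y n * (1 - \<epsilon>))"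
  proof (rule sub_critical_mono[OF half(2)])
    show "0 \<le> y n * (1 - \<epsilon>)" for n
      using assms(3)[of n] \<epsilon> by simp
    have "(1 - \<epsilon>) / (1 - \<epsilon>/2) < 1"
      using \<epsilon> by (simp add: field_simps)
    from order_tendstoD(1)[OF assms(4) this]
    show "\<forall>\<^sub>F n in sequentially. y n * (1 - \<epsilon>) \<le> x n * (1 - \<epsilon>/2)"
    proof eventually_elim
      case (elim n)
      moreover have "0 < 1 - \<epsilon>/2"
        using \<epsilon> by simp
      ultimately have "(1 - \<epsilon>) * y n < x n * (1 - \<epsilon>/2)"
        using assms(3)[of n] by (simp only: divide_less_eq less_divide_eq if_True times_divide_eq_left)
      then show ?case
        by (simp add: mult.commute)
    qed
  qed
qed

(* pseudo_graph: finite undirected graph, loops and parallel edges allowed; simple graphs are a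
   special case. Only adjacency of vertices matters for paths given as vertex sequences. *)
theorem proposition3:
  fixes G :: "nat \<Rightarrow> ('a, 'b) pre_digraph"
    and v :: "nat \<Rightarrow> 'a"
    and x y :: "nat \<Rightarrow> real"
  assumes "\<And>n. pseudo_graph (G n)"
    and "filterlim (\<lambda>n. card (verts (G n))) at_top sequentially"
    and "\<And>n. v n \<in> verts (G n)"
    and "\<And>n. 0 < x n"
    and "critical v G x"
    and "\<And>n. 0 < y n"
  shows "critical v G y \<longleftrightarrow> (\<lambda>n. x n / y n) \<longlonglongrightarrow> 1"
proof
  assume "critical v G y"
  with assms(5) show "(\<lambda>n. x n / y n) \<longlonglongrightarrow> 1"
    using assms(4,6) by (rule critical_ratio_tendsto_1)
next
  assume "(\<lambda>n. x n / y n) \<longlonglongrightarrow> 1"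
  with assms(5,4,6) show "critical v G y"
    by (rule critical_if_ratio_tendsto_1)
qed

end
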